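(* Let $H$ be a real Hilbert space with strong symplectic form $\omega$, and let $H_{\mathbb{C}}=W^+\oplus W^-$ be a positive symplectic polarization, with associated complex structure $J_W$ and associated sesquilinear form $g_W$ on $H_{\mathbb{C}}$. Then $J_W$ and $g_W$ restrict to a complex structure and an inner product on $H$. Moreover, $g_W$ is a positive definite sesquilinear form on $H_{\mathbb{C}}$, with respect to which $H_{\mathbb{C}}$ is a Hilbert space, and $(g_W,J_W,\omega)$ is a compatible triple on $H$.
   Context: Hilbert spaces are separable, possibly finite-dimensional. A strong inner product on a real Hilbert space $H$ is a continuous symmetric bilinear form $g$ with $g(v,v)\ge 0$ for all $v$ such that $\varphi_g:H\to H^*$, $\varphi_g(v)(w)=g(v,w)$, is a bounded linear bijection with bounded inverse. A strong symplectic form is a continuous anti-symmetric bilinear form $\omega$ such that $\varphi_\omega:H\to H^*$, $\varphi_\omega(v)(w)=\omega(v,w)$, is a bounded linear bijection with bounded inverse. All inner products and symplectic forms are assumed strong. A complex structure is a continuous linear map $J:H\to H$ with $J^2=-\mathrm{id}$. A compatible triple $(g,J,\omega)$ consists of a strong inner product, a complex structure and a strong symplectic form with $g(v,w)=\omega(v,Jw)$ for all $v,w\in H$. $H_{\mathbb{C}}=H\otimes_{\mathbb{R}}\mathbb{C}$ is the complexification and $\alpha:H_{\mathbb{C}}\to H_{\mathbb{C}}$ is the real-linear extension of $v\otimes\lambda\mapsto v\otimes\overline{\lambda}$; $H$ is identified with the $\alpha$-fixed vectors. The form $\omega$ is extended to $H_{\mathbb{C}}$ complex-bilinearly. A form is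 sesquilinear if it is complex-linear in the first entry, conjugate-linear in the second, and Hermitian-symmetric. A subspace $L\subset H_{\mathbb{C}}$ is isotropic if $\omega$ vanishes on $L\times L$; it is Lagrangian if it is isotropic and there is another isotropic subspace $L'$ with $H_{\mathbb{C}}=L\oplus L'$. A positive symplectic polarization is a direct sum decomposition $H_{\mathbb{C}}=W^+\oplus W^-$ into Lagrangian subspaces such that $\alpha(W^+)=W^-$ and $(v,w)\mapsto -i\,\omega(v,\alpha w)$ is a positive-definite sesquilinear form on $W^+$. Let $P_W^\pm:H_{\mathbb{C}}\to W^\pm$ be the projections with respect to this decomposition. The associated complex structure is $J_W=i(P_W^+-P_W^-)$ and the associated sesquilinear form is $g_W(v,w)=\omega(v,J_W\alpha w)$. *)

theory Defs
  imports "HOL-Analysis.Analysis"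
begin

section \<open>Linear structures on a real Hilbert space\<close>

text \<open>
  Separable real Hilbert spaces, possibly of finite dimension, are the types of sort
  \<open>{real_inner, polish_space}\<close>. The dual space of \<open>'h\<close> is the type \<open>'h \<Rightarrow>\<^sub>L real\<close> with the operator norm.
  \<open>Blinfun\<close> is meaningful only on bounded linear maps, so \<open>strong_form\<close> is used together with
  \<open>bounded_bilinear\<close>.
\<close>

definition strong_form :: "('h::{real_inner,polish_space} \<Rightarrow> 'h \<Rightarrow> real) \<Rightarrow> bool" where
  "strong_form b \<longleftrightarrow>
     (let \<phi> = (\<lambda>v. Blinfun (b v)) in bounded_linear \<phi> \<and> bij \<phi> \<and> bounded_linear (inv \<phi>))"

definition strong_inner_product :: "('h::{real_inner,polish_space} \<Rightarrow> 'h \<Rightarrow> real) \<Rightarrow> bool" where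
  "strong_inner_product g \<longleftrightarrow>
     bounded_bilinear g \<and> (\<forall>v w. g v w = g w v) \<and> (\<forall>v. g v v \<ge> 0) \<and> strong_form g"

definition strong_symplectic_form :: "('h::{real_inner,polish_space} \<Rightarrow> 'h \<Rightarrow> real) \<Rightarrow> bool" where
  "strong_symplectic_form \<omega> \<longleftrightarrow>
     bounded_bilinear \<omega> \<and> (\<forall>v w. \<omega> v w = - \<omega> w v) \<and> strong_form \<omega>"

definition complex_structure :: "('h::{real_inner,polish_space} \<Rightarrow> 'h) \<Rightarrow> bool" where
  "complex_structure J \<longleftrightarrow> bounded_linear J \<and> (\<forall>v. J (J v) = - v)"

definition compatible_triple ::
  "('h::{real_inner,polish_space} \<Rightarrow> 'h \<Rightarrow> real) \<Rightarrow> ('h \<Rightarrow> 'h) \<Rightarrow> ('h \<Rightarrow> 'h \<Rightarrow> real) \<Rightarrow> bool" where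
  "compatible_triple g J \<omega> \<longleftrightarrow>
     strong_inner_product g \<and> complex_structure J \<and> strong_symplectic_form \<omega> \<and>
     (\<forall>v w. g v w = \<omega> v (J w))"

section \<open>The complexification\<close>

text \<open>
  The pair \<open>(x, y)\<close> of type \<open>'h \<times> 'h\<close> represents \<open>x \<otimes> 1 + y \<otimes> \<i>\<close>; the pure tensor \<open>v \<otimes> \<lambda>\<close> is
  \<open>cscale \<lambda> (cembed v)\<close>.
\<close>

definition cscale :: "complex \<Rightarrow> 'h::real_vector \<times> 'h \<Rightarrow> 'h \<times> 'h" where
  "cscale c z = (Re c *\<^sub>R fst z - Im c *\<^sub>R snd z, Im c *\<^sub>R fst z + Re c *\<^sub>R snd z)"

definition cembed :: "'h::real_vector \<Rightarrow> 'h \<times> 'h" where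
  "cembed v = (v, 0)"

definition alpha :: "'h::real_vector \<times> 'h \<Rightarrow> 'h \<times> 'h" where
  "alpha z = (fst z, - snd z)"

definition cbilinear_ext ::
  "('h::real_vector \<Rightarrow> 'h \<Rightarrow> real) \<Rightarrow> 'h \<times> 'h \<Rightarrow> 'h \<times> 'h \<Rightarrow> complex" where
  "cbilinear_ext b z z' =
     Complex (b (fst z) (fst z') - b (snd z) (snd z')) (b (fst z) (snd z') + b (snd z) (fst z'))"

interpretation cvs: vector_space "cscale :: complex \<Rightarrow> 'h::real_vector \<times> 'h \<Rightarrow> 'h \<times> 'h"
  by unfold_locales (auto simp: cscale_def algebra_simps)

lemma alpha_tensor: "alpha (cscale c (cembed v)) = cscale (cnj c) (cembed v)"
  by (simp add: alpha_def cscale_def cembed_def)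

lemma alpha_fixed_iff: "alpha z = z \<longleftrightarrow> z \<in> range cembed"
proof -
  have "y = 0" if "- y = y" for y :: 'a
  proof -
    have "2 *\<^sub>R y = y - (- y)" by (simp add: scaleR_2)
    then show ?thesis using that by simp
  qed
  then show ?thesis
    by (cases z) (auto simp: alpha_def cembed_def)
qed

lemma cbilinear_ext_tensor:
  assumes "bounded_bilinear b"
  shows "cbilinear_ext b (cscale c (cembed v)) (cscale d (cembed w)) = c * d * of_real (b v w)"
proof -
  interpret bounded_bilinear b by fact
  show ?thesis
    by (simp add: cbilinear_ext_def cscale_def cembed_def scaleR_left scaleR_right complex_eq_iff
        algebra_simps)
qed

definition csesquilinear_on ::
  "('h::real_vector \<times> 'h) set \<Rightarrow> ('h \<times> 'h \<Rightarrow> 'h \<times> 'h \<Rightarrow> complex) \<Rightarrow> bool" where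
  "csesquilinear_on S B \<longleftrightarrow>
     (\<forall>u\<in>S. \<forall>v\<in>S. \<forall>w\<in>S. B (u + v) w = B u w + B v w \<and> B w (u + v) = B w u + B w v) \<and>
     (\<forall>v\<in>S. \<forall>w\<in>S. \<forall>c. B (cscale c v) w = c * B v w \<and> B v (cscale c w) = cnj c * B v w) \<and>
     (\<forall>v\<in>S. \<forall>w\<in>S. B w v = cnj (B v w))"

definition positive_definite_on ::
  "('h::real_vector \<times> 'h) set \<Rightarrow> ('h \<times> 'h \<Rightarrow> 'h \<times> 'h \<Rightarrow> complex) \<Rightarrow> bool" where
  "positive_definite_on S B \<longleftrightarrow> (\<forall>v\<in>S. v \<noteq> 0 \<longrightarrow> B v v \<in> \<real> \<and> 0 < Re (B v v))"

definition form_dist ::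
  "('h::real_vector \<times> 'h \<Rightarrow> 'h \<times> 'h \<Rightarrow> complex) \<Rightarrow> 'h \<times> 'h \<Rightarrow> 'h \<times> 'h \<Rightarrow> real" where
  "form_dist B v w = sqrt (Re (B (v - w) (v - w)))"

definition hilbert_space_wrt :: "('h::real_vector \<times> 'h \<Rightarrow> 'h \<times> 'h \<Rightarrow> complex) \<Rightarrow> bool" where
  "hilbert_space_wrt B \<longleftrightarrow>
     csesquilinear_on UNIV B \<and> positive_definite_on UNIV B \<and>
     Metric_space UNIV (form_dist B) \<and>
     Metric_space.mcomplete UNIV (form_dist B) \<and>
     separable_space (Metric_space.mtopology UNIV (form_dist B))"

section \<open>Positive symplectic polarizations\<close>

definition direct_sum_decomp :: "('h::real_vector \<times> 'h) set \<Rightarrow> ('h \<times> 'h) set \<Rightarrow> bool" where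
  "direct_sum_decomp A B \<longleftrightarrow>
     cvs.subspace A \<and> cvs.subspace B \<and> A \<inter> B = {0} \<and> (\<forall>z. \<exists>a\<in>A. \<exists>b\<in>B. z = a + b)"

definition isotropic :: "('h::real_vector \<Rightarrow> 'h \<Rightarrow> real) \<Rightarrow> ('h \<times> 'h) set \<Rightarrow> bool" where
  "isotropic \<omega> L \<longleftrightarrow> cvs.subspace L \<and> (\<forall>v\<in>L. \<forall>w\<in>L. cbilinear_ext \<omega> v w = 0)"

text \<open>
  Subspaces are not required to be closed: for a strong symplectic form, a Lagrangian equals its own
  symplectic complement and is therefore closed.
\<close>

definition lagrangian :: "('h::real_vector \<Rightarrow> 'h \<Rightarrow> real) \<Rightarrow> ('h \<times> 'h) set \<Rightarrow> bool" where
  "lagrangian \<omega> L \<longleftrightarrow> isotropic \<omega> L \<and> (\<exists>L'. isotropic \<omega> L' \<and> direct_sum_decomp L L')"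

definition positive_symplectic_polarization ::
  "('h::real_vector \<Rightarrow> 'h \<Rightarrow> real) \<Rightarrow> ('h \<times> 'h) set \<Rightarrow> ('h \<times> 'h) set \<Rightarrow> bool" where
  "positive_symplectic_polarization \<omega> Wp Wm \<longleftrightarrow>
     direct_sum_decomp Wp Wm \<and> lagrangian \<omega> Wp \<and> lagrangian \<omega> Wm \<and> alpha ` Wp = Wm \<and>
     csesquilinear_on Wp (\<lambda>v w. - \<i> * cbilinear_ext \<omega> v (alpha w)) \<and>
     positive_definite_on Wp (\<lambda>v w. - \<i> * cbilinear_ext \<omega> v (alpha w))"

definition proj_along :: "('h::real_vector \<times> 'h) set \<Rightarrow> ('h \<times> 'h) set \<Rightarrow> 'h \<times> 'h \<Rightarrow> 'h \<times> 'h" where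
  "proj_along A B z = (THE a. a \<in> A \<and> z - a \<in> B)"

definition pol_J :: "('h::real_vector \<times> 'h) set \<Rightarrow> ('h \<times> 'h) set \<Rightarrow> 'h \<times> 'h \<Rightarrow> 'h \<times> 'h" where
  "pol_J Wp Wm z = cscale \<i> (proj_along Wp Wm z - proj_along Wm Wp z)"

definition pol_g ::
  "('h::real_vector \<Rightarrow> 'h \<Rightarrow> real) \<Rightarrow> ('h \<times> 'h) set \<Rightarrow> ('h \<times> 'h) set \<Rightarrow> 'h \<times> 'h \<Rightarrow> 'h \<times> 'h \<Rightarrow> complex"
  where
  "pol_g \<omega> Wp Wm v w = cbilinear_ext \<omega> v (pol_J Wp Wm (alpha w))"

end

theory Submission
  imports Defs
begin

text \<open>
  The polarization makes \<open>J\<^sub>W\<close> complex-linear with square \<open>-1\<close>. Conjugation exchanges \<open>W\<^sup>+\<close> and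
  \<open>W\<^sup>-\<close> as well as \<open>\<i>\<close> and \<open>-\<i>\<close>, so \<open>J\<^sub>W\<close> commutes with it and is the complexification of a
  real linear map \<open>J\<close> of \<open>H\<close> (\<open>pol_J_real\<close>). As both halves are isotropic, only the mixed terms
  of \<open>\<omega>\<close> survive, and \<open>J\<^sub>W\<close> multiplies these by \<open>\<i> \<cdot> (-\<i>) = 1\<close>; hence \<open>J\<close> preserves \<open>\<omega>\<close>
  (\<open>pol_J_invariant\<close>) and \<open>g(v,w) = \<omega>(v, J w)\<close> is symmetric. A real vector is \<open>a + \<alpha> a\<close> with
  \<open>a\<close> in \<open>W\<^sup>+\<close>, and its \<open>g\<close>-square is twice the value at \<open>a\<close> of the form that is positive by
  assumption (\<open>polarization_taming\<close>).

  This algebra says nothing about continuity of \<open>J\<close>. That is automatic, by an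
  argument in the style of Hellinger and Toeplitz: \<open>g\<close> is symmetric, positive, and continuous in
  its first argument because \<open>\<omega>\<close> is, so the uniform boundedness principle makes it jointly bounded
  (\<open>positive_form_bounded\<close>). As \<open>\<omega>\<close> is strong, a vector is controlled by the functional it
  represents, and the bound on \<open>g\<close> becomes a bound on \<open>J\<close>. Then \<open>g\<close> is \<open>\<omega>\<close> precomposed
  with the isomorphism \<open>-J\<close>, hence strong as well (\<open>tamed_symplectic_compatible\<close>).

  On all of \<open>H\<^sub>\<complex>\<close> the form \<open>g\<^sub>W\<close> is the Hermitian extension of \<open>g\<close>. A strong inner product is
  comparable to the square of the given norm (\<open>strong_inner_product_coercive\<close>), so the metric of
  \<open>g\<^sub>W\<close> is equivalent to the product metric and inherits completeness and separability
  (\<open>hermitian_extension_hilbert\<close>).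
\<close>

section \<open>Bilinear forms on Banach spaces\<close>

text \<open>
  By the Baire category theorem, one of the closed sets on which all members of \<open>F\<close> are bounded by
  a given \<open>n\<close> contains a ball; translating this ball to the origin costs a factor of two.
\<close>

lemma uniform_boundedness_functionals:
  fixes F :: "('a::{real_normed_vector,complete_space} \<Rightarrow> real) set"
  assumes lin: "\<And>f. f \<in> F \<Longrightarrow> bounded_linear f"
    and pointwise: "\<And>x. \<exists>B. \<forall>f\<in>F. \<bar>f x\<bar> \<le> B"
  obtains C where "0 \<le> C" "\<And>f x. f \<in> F \<Longrightarrow> \<bar>f x\<bar> \<le> C * norm x"
proof -
  define S where "S n = {x. \<forall>f\<in>F. \<bar>f x\<bar> \<le> real n}" for n :: nat
  have closed_S: "closed (S n)" for n
  proof -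
    have "S n = (\<Inter>f\<in>F. {x. \<bar>f x\<bar> \<le> real n})"
      by (auto simp: S_def)
    moreover have "closed {x. \<bar>f x\<bar> \<le> real n}" if "f \<in> F" for f
      by (intro closed_Collect_le continuous_intros
          linear_continuous_on[OF lin[OF that], of UNIV])
    ultimately show ?thesis
      by auto
  qed
  have cover: "(\<Union>n. S n) = UNIV"
  proof -
    have "\<exists>n. x \<in> S n" for x
    proof -
      obtain B where B: "\<forall>f\<in>F. \<bar>f x\<bar> \<le> B"
        using pointwise by blast
      obtain n :: nat where "B \<le> real n"
        using real_arch_simple by blast
      with B show ?thesis
        by (auto simp: S_def intro: order_trans)
    qed
    then show ?thesis
      by auto
  qed
  have "\<exists>n. interior (S n) \<noteq> {}"
  proof (rule ccontr)
    assume "\<not> (\<exists>n. interior (S n) \<noteq> {})"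
    then have "Met_TC.mtopology interior_of \<Union>(range S) = {}"
      using closed_S
      by (intro Met_TC.metric_Baire_category_alt) (auto simp: complete_UNIV)
    then show False
      using cover by simp
  qed
  then obtain n x0 where "x0 \<in> interior (S n)"
    by blast
  then obtain e where e: "0 < e" "cball x0 e \<subseteq> S n"
    by (auto simp: mem_interior_cball)
  have small: "\<bar>f x\<bar> \<le> 2 * real n" if "f \<in> F" "norm x \<le> e" for f x
  proof -
    interpret bounded_linear f
      by (rule lin) fact
    have "x0 + x \<in> S n" "x0 \<in> S n"
      using e that by (auto simp: subset_iff dist_norm)
    then have "\<bar>f (x0 + x)\<bar> \<le> real n" "\<bar>f x0\<bar> \<le> real n"
      using that by (auto simp: S_def)
    then show ?thesis
      by (simp add: add)
  qed
  show thesis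
  proof
    show "0 \<le> 2 * real n / e"
      using e by simp
    show "\<bar>f x\<bar> \<le> 2 * real n / e * norm x" if "f \<in> F" for f x
    proof (cases "x = 0")
      case True
      then show ?thesis
        using lin[OF that] by (simp add: linear_simps)
    next
      case False
      interpret bounded_linear f
        by (rule lin) fact
      have "\<bar>f ((e / norm x) *\<^sub>R x)\<bar> \<le> 2 * real n"
        using small[OF that, of "(e / norm x) *\<^sub>R x"] e False by simp
      then show ?thesis
        using False e by (simp add: scaleR abs_mult field_simps)
    qed
  qed
qed

text \<open>
  For possibly degenerate forms on a space without topology: the inequality serves to prove
  boundedness and definiteness of forms that are so far only known to be nonnegative.
\<close>
lemma bilinear_Cauchy_Schwarz:
  fixes b :: "'a::real_vector \<Rightarrow> 'a \<Rightarrow> real"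
  assumes "bilinear b" and sym: "\<And>v w. b v w = b w v" and nonneg: "\<And>v. 0 \<le> b v v"
  shows "\<bar>b v w\<bar> \<le> sqrt (b v v) * sqrt (b w w)"
proof -
  note simps = bilinear_ladd[OF \<open>bilinear b\<close>] bilinear_radd[OF \<open>bilinear b\<close>]
    bilinear_lmul[OF \<open>bilinear b\<close>] bilinear_rmul[OF \<open>bilinear b\<close>]
    bilinear_lsub[OF \<open>bilinear b\<close>] bilinear_rsub[OF \<open>bilinear b\<close>]
  have quad: "0 \<le> b v v - 2 * t * b v w + t\<^sup>2 * b w w" for t
    using nonneg[of "v - t *\<^sub>R w"] sym[of w v]
    by (simp add: simps power2_eq_square algebra_simps)
  have "(b v w)\<^sup>2 \<le> b v v * b w w"
  proof (cases "b w w = 0")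
    case True
    have "b v w = 0"
    proof (rule ccontr)
      assume "b v w \<noteq> 0"
      \<comment> \<open>The quadratic polynomial is affine in \<open>t\<close>; this \<open>t\<close> gives it the value \<open>-1\<close>.\<close>
      then show False
        using quad[of "(b v v + 1) / (2 * b v w)"] True by simp
    qed
    then show ?thesis
      using True by simp
  next
    case False
    then have "0 < b w w"
      using nonneg[of w] by simp
    \<comment> \<open>The minimum of the quadratic polynomial is at \<open>t = b v w / b w w\<close>.\<close>
    then show ?thesis
      using quad[of "b v w / b w w"] by (simp add: power2_eq_square field_simps)
  qed
  then have "sqrt ((b v w)\<^sup>2) \<le> sqrt (b v v * b w w)"
    by (rule real_sqrt_le_mono)
  then show ?thesis
    by (simp only: real_sqrt_abs real_sqrt_mult)
qed

lemma bilinear_triangle: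
  fixes b :: "'a::real_vector \<Rightarrow> 'a \<Rightarrow> real"
  assumes "bilinear b" and sym: "\<And>v w. b v w = b w v" and nonneg: "\<And>v. 0 \<le> b v v"
  shows "sqrt (b (v + w) (v + w)) \<le> sqrt (b v v) + sqrt (b w w)"
proof (rule real_le_lsqrt)
  have "b (v + w) (v + w) = b v v + 2 * b v w + b w w"
    using sym[of w v]
    by (simp add: bilinear_ladd[OF \<open>bilinear b\<close>] bilinear_radd[OF \<open>bilinear b\<close>])
  also have "\<dots> \<le> b v v + 2 * (sqrt (b v v) * sqrt (b w w)) + b w w"
    using bilinear_Cauchy_Schwarz[OF assms, of v w] by simp
  also have "\<dots> = (sqrt (b v v) + sqrt (b w w))\<^sup>2"
    by (simp add: power2_sum nonneg)
  finally show "b (v + w) (v + w) \<le> (sqrt (b v v) + sqrt (b w w))\<^sup>2" .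
qed (simp add: nonneg)

text \<open>
  The functionals \<open>\<lambda>v. b v w\<close> with \<open>b w w \<le> 1\<close> are bounded at each \<open>v\<close> by the Cauchy-Schwarz
  inequality, hence uniformly. Evaluating at \<open>v\<close> the functional of the normalized vector \<open>v\<close>
  gives \<open>sqrt (b v v)\<close>, which is thus at most \<open>C * norm v\<close>.
\<close>
lemma positive_form_bounded:
  fixes b :: "'a::{real_normed_vector,complete_space} \<Rightarrow> 'a \<Rightarrow> real"
  assumes sym: "\<And>v w. b v w = b w v" and nonneg: "\<And>v. 0 \<le> b v v"
    and cont: "\<And>w. bounded_linear (\<lambda>v. b v w)"
  obtains C where "0 \<le> C" "\<And>v w. \<bar>b v w\<bar> \<le> C * norm v * norm w"
proof -
  have cont': "bounded_linear (b v)" for v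
    using cont[of v] by (simp add: sym[of _ v])
  have bil: "bilinear b"
    unfolding bilinear_def using cont cont' by (auto intro: bounded_linear.linear)
  note CS = bilinear_Cauchy_Schwarz[OF bil sym nonneg]
  define F where "F = {\<lambda>v. b v w |w. b w w \<le> 1}"
  obtain C where C: "0 \<le> C" "\<And>f v. f \<in> F \<Longrightarrow> \<bar>f v\<bar> \<le> C * norm v"
  proof (rule uniform_boundedness_functionals[of F])
    show "bounded_linear f" if "f \<in> F" for f
      using that cont by (auto simp: F_def)
    show "\<exists>B. \<forall>f\<in>F. \<bar>f v\<bar> \<le> B" for v
    proof -
      have "\<bar>b v w\<bar> \<le> sqrt (b v v)" if "b w w \<le> 1" for w
      proof -
        have "sqrt (b v v) * sqrt (b w w) \<le> sqrt (b v v) * 1"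
          using that nonneg by (intro mult_left_mono) auto
        then show ?thesis
          using CS[of v w] by simp
      qed
      then show ?thesis
        by (auto simp: F_def)
    qed
  qed (rule that)
  have root: "sqrt (b v v) \<le> C * norm v" for v
  proof (cases "b v v = 0")
    case True
    then show ?thesis
      using C(1) by simp
  next
    case False
    then have pos: "0 < sqrt (b v v)"
      using nonneg[of v] by simp
    define w where "w = (1 / sqrt (b v v)) *\<^sub>R v"
    have "b w w = b v v / (sqrt (b v v) * sqrt (b v v))"
      by (simp add: w_def bilinear_lmul[OF bil] bilinear_rmul[OF bil])
    then have "b w w = 1"
      using pos by simp
    then have "\<bar>b v w\<bar> \<le> C * norm v"
      by (intro C(2)[of "\<lambda>v. b v w" v]) (auto simp: F_def)
    moreover have "b v w = b v v / sqrt (b v v)"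
      by (simp add: w_def bilinear_rmul[OF bil])
    then have "b v w = sqrt (b v v)"
      using real_div_sqrt[OF nonneg] by simp
    ultimately show ?thesis
      by simp
  qed
  show thesis
  proof
    show "0 \<le> C * C"
      by simp
    show "\<bar>b v w\<bar> \<le> C * C * norm v * norm w" for v w
    proof -
      have "sqrt (b v v) * sqrt (b w w) \<le> (C * norm v) * (C * norm w)"
        using C(1) nonneg by (intro mult_mono root) auto
      with CS[of v w] show ?thesis
        by (simp add: mult_ac)
    qed
  qed
qed

section \<open>Strong forms\<close>

text \<open>
  The hypothesis on \<open>C\<close> bounds the dual norm of the functional \<open>b v\<close>, and \<open>K\<close> is a bound for the
  inverse of the isomorphism onto the dual.
\<close>
lemma strong_form_lower_bound:
  assumes "bounded_bilinear b" "strong_form b"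
  obtains K where "0 < K" "\<And>v C. 0 \<le> C \<Longrightarrow> (\<And>w. \<bar>b v w\<bar> \<le> C * norm w) \<Longrightarrow> norm v \<le> K * C"
proof -
  define \<phi> where "\<phi> v = Blinfun (b v)" for v
  have inv: "bounded_linear (inv \<phi>)" and bij: "bij \<phi>"
    using assms(2) by (auto simp: strong_form_def \<phi>_def[abs_def] Let_def)
  obtain K where K: "0 < K" "\<And>f. norm (inv \<phi> f) \<le> norm f * K"
    using bounded_linear.pos_bounded[OF inv] by auto
  have app: "blinfun_apply (\<phi> v) = b v" for v
    unfolding \<phi>_def
    by (intro bounded_linear_Blinfun_apply bounded_bilinear.bounded_linear_right[OF assms(1)])
  show thesis
  proof
    show "0 < K" by fact
    show "norm v \<le> K * C" if "0 \<le> C" "\<And>w. \<bar>b v w\<bar> \<le> C * norm w" for v C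
    proof -
      have "norm (\<phi> v) \<le> C"
        using that by (intro norm_blinfun_bound) (auto simp: app)
      then have "norm (\<phi> v) * K \<le> C * K"
        using K(1) by simp
      moreover have "inv \<phi> (\<phi> v) = v"
        using bij by (simp add: bij_is_inj)
      ultimately show ?thesis
        using K(2)[of "\<phi> v"] by (simp add: mult.commute)
    qed
  qed
qed

lemma strong_form_compose:
  assumes "strong_form b" "bounded_linear A" "bounded_linear A'"
    and "\<And>v. A (A' v) = v" "\<And>v. A' (A v) = v"
  shows "strong_form (\<lambda>v. b (A v))"
proof -
  define \<phi> where "\<phi> v = Blinfun (b v)" for v
  have \<phi>: "bounded_linear \<phi>" "bij \<phi>" "bounded_linear (inv \<phi>)"
    using assms(1) by (auto simp: strong_form_def \<phi>_def[abs_def] Let_def)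
  have A: "bij A" "inv A = A'"
    using assms(4,5) by (auto intro!: o_bij[of A'] inv_equality)
  have "(\<lambda>v. Blinfun (b (A v))) = \<phi> \<circ> A"
    by (auto simp: \<phi>_def)
  moreover have "bounded_linear (\<phi> \<circ> A)"
    using bounded_linear_compose[OF \<phi>(1) assms(2)] by (simp add: o_def)
  moreover have "bij (\<phi> \<circ> A)"
    using \<phi>(2) A(1) by (rule bij_comp[rotated])
  moreover have "bounded_linear (inv (\<phi> \<circ> A))"
    using bounded_linear_compose[OF assms(3) \<phi>(3)] A \<phi>(2)
    by (simp add: o_inv_distrib comp_def[of A'])
  ultimately show ?thesis
    by (simp add: strong_form_def Let_def)
qed

text \<open>
  For the lower bound, the Cauchy-Schwarz inequality and the upper bound show that the functional
  \<open>g v\<close> has norm at most \<open>sqrt (g v v) * sqrt C\<close>; strength turns this into a bound on \<open>norm v\<close>.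
\<close>
lemma strong_inner_product_coercive:
  assumes "strong_inner_product g"
  obtains c C where "0 < c" "0 < C" "\<And>v. c * (norm v)\<^sup>2 \<le> g v v" "\<And>v. g v v \<le> C * (norm v)\<^sup>2"
proof -
  have bb: "bounded_bilinear g" and sym: "\<And>v w. g v w = g w v" and nonneg: "\<And>v. 0 \<le> g v v"
    and strong: "strong_form g"
    using assms by (auto simp: strong_inner_product_def)
  interpret bounded_bilinear g by fact
  have bil: "bilinear g"
    unfolding bilinear_def
    using bounded_linear_left bounded_linear_right by (auto intro: bounded_linear.linear)
  obtain C where C: "0 < C" "\<And>v w. norm (g v w) \<le> norm v * norm w * C"
    using pos_bounded by auto
  obtain K where K: "0 < K"
    "\<And>v C. 0 \<le> C \<Longrightarrow> (\<And>w. \<bar>g v w\<bar> \<le> C * norm w) \<Longrightarrow> norm v \<le> K * C"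
    using strong_form_lower_bound[OF bb strong] by metis
  have upper: "g v v \<le> C * (norm v)\<^sup>2" for v
    using C(2)[of v v] by (simp add: power2_eq_square mult_ac)
  have "(norm v)\<^sup>2 \<le> K\<^sup>2 * C * g v v" for v
  proof -
    have "norm v \<le> K * (sqrt (g v v) * sqrt C)"
    proof (rule K(2))
      show "\<bar>g v w\<bar> \<le> sqrt (g v v) * sqrt C * norm w" for w
      proof -
        have "sqrt (g w w) \<le> sqrt (C * (norm w)\<^sup>2)"
          using upper[of w] by simp
        also have "\<dots> = sqrt C * norm w"
          by (simp add: real_sqrt_mult)
        finally have "sqrt (g v v) * sqrt (g w w) \<le> sqrt (g v v) * (sqrt C * norm w)"
          by (intro mult_left_mono) (auto simp: nonneg)
        with bilinear_Cauchy_Schwarz[OF bil sym nonneg, of v w] show ?thesis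
          by (simp add: mult.assoc)
      qed
    qed (use C nonneg in auto)
    then have "(norm v)\<^sup>2 \<le> (K * (sqrt (g v v) * sqrt C))\<^sup>2"
      by (simp add: power_mono)
    then show ?thesis
      using C(1) nonneg by (simp add: power_mult_distrib mult_ac)
  qed
  then have "1 / (K\<^sup>2 * C) * (norm v)\<^sup>2 \<le> g v v" for v
    using C(1) K(1) by (simp add: field_simps)
  then show thesis
    using that[of "1 / (K\<^sup>2 * C)" C] C K upper by simp
qed

text \<open>
  A merely linear \<open>J\<close> is automatically continuous: \<open>\<omega> (J v) w\<close> equals \<open>- \<omega> v (J w)\<close>, which
  \<open>positive_form_bounded\<close> bounds by a multiple of \<open>norm v * norm w\<close>.
\<close>
theorem tamed_symplectic_compatible:
  fixes \<omega> :: "'h::{real_inner,polish_space} \<Rightarrow> 'h \<Rightarrow> real"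
  assumes \<omega>: "strong_symplectic_form \<omega>"
    and JJ: "\<And>v. J (J v) = - v"
    and invariant: "\<And>v w. \<omega> (J v) (J w) = \<omega> v w"
    and taming: "\<And>v. 0 \<le> \<omega> v (J v)"
    and lin: "linear J"
  shows "compatible_triple (\<lambda>v w. \<omega> v (J w)) J \<omega>"
proof -
  have bb: "bounded_bilinear \<omega>" and skew: "\<And>v w. \<omega> v w = - \<omega> w v" and strong: "strong_form \<omega>"
    using \<omega> unfolding strong_symplectic_form_def by blast+
  interpret \<omega>: bounded_bilinear \<omega> by fact
  have left: "\<omega> v (J w) = \<omega> (- J v) w" for v w
    using invariant[of v "J w"] by (simp add: JJ \<omega>.minus_left \<omega>.minus_right)
  have sym: "\<omega> v (J w) = \<omega> w (J v)" for v w
    using skew[of "J v" w] by (simp add: left \<omega>.minus_left)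
  obtain C where C: "0 \<le> C" "\<And>v w. \<bar>\<omega> v (J w)\<bar> \<le> C * norm v * norm w"
    using positive_form_bounded[of "\<lambda>v w. \<omega> v (J w)"] sym taming \<omega>.bounded_linear_left by metis
  obtain K where K: "0 < K"
    "\<And>v C. 0 \<le> C \<Longrightarrow> (\<And>w. \<bar>\<omega> v w\<bar> \<le> C * norm w) \<Longrightarrow> norm v \<le> K * C"
    using strong_form_lower_bound[OF bb strong] by metis
  have J_bound: "norm (J v) \<le> norm v * (K * C)" for v
  proof -
    have "norm (J v) \<le> K * (C * norm v)"
    proof (rule K(2))
      show "\<bar>\<omega> (J v) w\<bar> \<le> C * norm v * norm w" for w
        using C(2)[of v w] by (simp add: left \<omega>.minus_left)
    qed (use C in auto)
    then show ?thesis
      by (simp add: mult_ac)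
  qed
  have J: "bounded_linear J"
    using J_bound by (intro bounded_linear.intro[OF lin] bounded_linear_axioms.intro) blast
  have "bounded_bilinear (\<lambda>v w. \<omega> v (J w))"
    by (rule \<omega>.comp[OF bounded_linear_ident J])
  moreover have "strong_form (\<lambda>v w. \<omega> v (J w))"
  proof -
    have "strong_form (\<lambda>v. \<omega> (- J v))"
      using J by (intro strong_form_compose[OF strong _ J])
        (auto simp: JJ linear_neg[OF lin] intro: bounded_linear_minus)
    then show ?thesis
      by (simp add: left)
  qed
  ultimately show ?thesis
    using \<omega> J JJ sym taming
    by (auto simp: compatible_triple_def strong_inner_product_def complex_structure_def)
qed

section \<open>The Hermitian extension of an inner product\<close>

lemma equivalent_metric:
  fixes d :: "'a::metric_space \<Rightarrow> 'a \<Rightarrow> real"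
  assumes "Metric_space UNIV d" "0 < c" "0 < C"
    and lower: "\<And>x y. c * dist x y \<le> d x y" and upper: "\<And>x y. d x y \<le> C * dist x y"
  shows "Metric_space.mtopology UNIV d = euclidean"
    and "Metric_space.MCauchy UNIV d = Cauchy"
proof -
  interpret Metric_space UNIV d by fact
  have small_d: "d x y < e" if "dist x y < e / C" for x y e
    using that upper[of x y] \<open>0 < C\<close> by (simp add: field_simps)
  have small_dist: "dist x y < e" if "d x y < c * e" for x y e
    using that lower[of x y] \<open>0 < c\<close> by (metis mult_less_cancel_left_pos order_le_less_trans)
  show "mtopology = euclidean"
  proof (rule topology_eq[THEN iffD2], intro allI)
    fix U :: "'a set"
    have "(\<exists>r>0. mball x r \<subseteq> U) \<longleftrightarrow> (\<exists>r>0. ball x r \<subseteq> U)" for x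
    proof
      assume "\<exists>r>0. mball x r \<subseteq> U"
      then obtain r where r: "0 < r" "mball x r \<subseteq> U"
        by blast
      then have "ball x (r / C) \<subseteq> U"
        using small_d by auto
      then show "\<exists>r>0. ball x r \<subseteq> U"
        using r \<open>0 < C\<close> by (intro exI[of _ "r / C"]) simp
    next
      assume "\<exists>r>0. ball x r \<subseteq> U"
      then obtain r where r: "0 < r" "ball x r \<subseteq> U"
        by blast
      then have "mball x (c * r) \<subseteq> U"
        using small_dist by auto
      then show "\<exists>r>0. mball x r \<subseteq> U"
        using r \<open>0 < c\<close> by (intro exI[of _ "c * r"]) simp
    qed
    then show "openin mtopology U \<longleftrightarrow> openin euclidean U"
      by (auto simp: openin_mtopology open_contains_ball)
  qed
  show "MCauchy = Cauchy"
  proof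
    fix s :: "nat \<Rightarrow> 'a"
    show "MCauchy s = Cauchy s"
    proof
      assume s: "MCauchy s"
      show "Cauchy s"
      proof (rule metric_CauchyI)
        fix e :: real
        assume "0 < e"
        then have "0 < c * e"
          using \<open>0 < c\<close> by simp
        then obtain N where "\<forall>n n'. N \<le> n \<longrightarrow> N \<le> n' \<longrightarrow> d (s n) (s n') < c * e"
          using s unfolding MCauchy_def by blast
        then show "\<exists>M. \<forall>m\<ge>M. \<forall>n\<ge>M. dist (s m) (s n) < e"
          using small_dist by blast
      qed
    next
      assume s: "Cauchy s"
      have "\<exists>N. \<forall>n n'. N \<le> n \<longrightarrow> N \<le> n' \<longrightarrow> d (s n) (s n') < e" if "0 < e" for e
      proof -
        have "0 < e / C"
          using that \<open>0 < C\<close> by simp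
        then obtain N where "\<forall>m\<ge>N. \<forall>n\<ge>N. dist (s m) (s n) < e / C"
          using s unfolding Cauchy_def by blast
        then show ?thesis
          using small_d by blast
      qed
      then show "MCauchy s"
        by (simp add: MCauchy_def)
    qed
  qed
qed

lemma separable_space_euclidean:
  "separable_space (euclidean :: 'a::second_countable_topology topology)"
proof -
  obtain D :: "'a set" where D: "countable D" "\<And>X. open X \<Longrightarrow> X \<noteq> {} \<Longrightarrow> \<exists>d\<in>D. d \<in> X"
    using countable_dense_setE by blast
  have "closure D = UNIV"
    using D(2)[of "- closure D"] closure_subset[of D] by blast
  then show ?thesis
    using D(1) by (auto simp: separable_space_def)
qed

text \<open>
  The real part of the extended form is the orthogonal sum of two copies of \<open>g\<close>, so both its
  definiteness and its comparison with the product norm reduce to those of \<open>g\<close>.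
\<close>
theorem hermitian_extension_hilbert:
  fixes g :: "'h::{real_inner,polish_space} \<Rightarrow> 'h \<Rightarrow> real"
  assumes g: "strong_inner_product g"
  defines "B \<equiv> \<lambda>v w. cbilinear_ext g v (alpha w)"
  shows "hilbert_space_wrt B"
proof -
  have sym: "\<And>v w. g v w = g w v"
    using g by (auto simp: strong_inner_product_def)
  interpret bounded_bilinear g
    using g by (auto simp: strong_inner_product_def)
  obtain c C where cC: "0 < c" "0 < C" "\<And>v. c * (norm v)\<^sup>2 \<le> g v v" "\<And>v. g v v \<le> C * (norm v)\<^sup>2"
    using strong_inner_product_coercive[OF g] by metis
  have Re_B: "Re (B v w) = g (fst v) (fst w) + g (snd v) (snd w)" for v w
    by (simp add: B_def cbilinear_ext_def alpha_def minus_right)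
  have Im_B: "Im (B v w) = g (snd v) (fst w) - g (fst v) (snd w)" for v w
    by (simp add: B_def cbilinear_ext_def alpha_def minus_right)
  have sesq: "csesquilinear_on UNIV B"
    unfolding csesquilinear_on_def
    by (auto simp: complex_eq_iff Re_B Im_B cscale_def add_left add_right diff_left diff_right
        scaleR_left scaleR_right algebra_simps sym)
  have norm_sq: "(norm z)\<^sup>2 = (norm (fst z))\<^sup>2 + (norm (snd z))\<^sup>2" for z :: "'h \<times> 'h"
    by (cases z) (simp add: norm_Pair)
  have lower: "c * (norm z)\<^sup>2 \<le> Re (B z z)" and upper: "Re (B z z) \<le> C * (norm z)\<^sup>2" for z
    using cC(3)[of "fst z"] cC(3)[of "snd z"] cC(4)[of "fst z"] cC(4)[of "snd z"]
    by (auto simp: Re_B norm_sq algebra_simps)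
  have pos: "0 < Re (B z z)" if "z \<noteq> 0" for z
    using lower[of z] that cC(1) by (smt (verit) mult_pos_pos zero_less_norm_iff zero_less_power)
  have posdef: "positive_definite_on UNIV B"
    using pos by (auto simp: positive_definite_on_def complex_is_Real_iff Im_B sym)
  have bil: "bilinear (\<lambda>v w. Re (B v w))"
    by (auto simp: bilinear_def linear_iff Re_B add_left add_right scaleR_left scaleR_right
        algebra_simps)
  have nonneg: "0 \<le> Re (B z z)" for z
    using lower[of z] cC(1) by (smt (verit) mult_nonneg_nonneg zero_le_power2)
  have symB: "Re (B v w) = Re (B w v)" for v w
    by (simp add: Re_B sym)
  have dist_lower: "sqrt c * dist v w \<le> form_dist B v w" for v w
    using real_sqrt_le_mono[OF lower[of "v - w"]]
    by (simp add: form_dist_def dist_norm real_sqrt_mult)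
  have dist_upper: "form_dist B v w \<le> sqrt C * dist v w" for v w
    using real_sqrt_le_mono[OF upper[of "v - w"]]
    by (simp add: form_dist_def dist_norm real_sqrt_mult)
  have metric: "Metric_space UNIV (form_dist B)"
  proof
    fix x y z :: "'h \<times> 'h"
    show "0 \<le> form_dist B x y"
      by (simp add: form_dist_def nonneg)
    show "form_dist B x y = form_dist B y x"
      by (simp add: form_dist_def Re_B diff_left diff_right algebra_simps)
    show "form_dist B x y = 0 \<longleftrightarrow> x = y"
    proof
      assume "form_dist B x y = 0"
      then show "x = y"
        using dist_lower[of x y] cC(1) by (simp add: mult_le_0_iff)
    next
      assume "x = y"
      then show "form_dist B x y = 0"
        by (simp add: form_dist_def Re_B zero_left)
    qed
    show "form_dist B x z \<le> form_dist B x y + form_dist B y z"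
      using bilinear_triangle[OF bil symB nonneg, of "x - y" "y - z"]
      by (simp add: form_dist_def)
  qed
  have top: "Metric_space.mtopology UNIV (form_dist B) = euclidean"
    and Cau: "Metric_space.MCauchy UNIV (form_dist B) = Cauchy"
    using equivalent_metric[OF metric _ _ dist_lower dist_upper] cC by auto
  have "Metric_space.mcomplete UNIV (form_dist B)"
    unfolding Metric_space.mcomplete_def[OF metric] top Cau
    by (auto simp: Cauchy_convergent_iff convergent_def)
  then show ?thesis
    using sesq posdef metric
    by (simp add: hilbert_space_wrt_def top separable_space_euclidean)
qed

section \<open>The complex structure of a polarization\<close>

lemma cbilinear_ext_simps:
  assumes "bounded_bilinear b"
  shows "cbilinear_ext b (u + v) w = cbilinear_ext b u w + cbilinear_ext b v w"
    and "cbilinear_ext b w (u + v) = cbilinear_ext b w u + cbilinear_ext b w v"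
    and "cbilinear_ext b (u - v) w = cbilinear_ext b u w - cbilinear_ext b v w"
    and "cbilinear_ext b w (u - v) = cbilinear_ext b w u - cbilinear_ext b w v"
    and "cbilinear_ext b (cscale c u) w = c * cbilinear_ext b u w"
    and "cbilinear_ext b w (cscale c u) = c * cbilinear_ext b w u"
proof -
  interpret bounded_bilinear b by fact
  show "cbilinear_ext b (u + v) w = cbilinear_ext b u w + cbilinear_ext b v w"
    "cbilinear_ext b w (u + v) = cbilinear_ext b w u + cbilinear_ext b w v"
    "cbilinear_ext b (u - v) w = cbilinear_ext b u w - cbilinear_ext b v w"
    "cbilinear_ext b w (u - v) = cbilinear_ext b w u - cbilinear_ext b w v"
    "cbilinear_ext b (cscale c u) w = c * cbilinear_ext b u w"
    "cbilinear_ext b w (cscale c u) = c * cbilinear_ext b w u"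
    by (auto simp: cbilinear_ext_def cscale_def complex_eq_iff add_left add_right diff_left
        diff_right scaleR_left scaleR_right algebra_simps)
qed

lemma proj_along_add:
  assumes "direct_sum_decomp A B" "a \<in> A" "b \<in> B"
  shows "proj_along A B (a + b) = a"
  unfolding proj_along_def
proof (rule the_equality)
  show "a \<in> A \<and> a + b - a \<in> B"
    using assms by simp
next
  fix a'
  assume a': "a' \<in> A \<and> a + b - a' \<in> B"
  have sub: "cvs.subspace A" "cvs.subspace B" and int: "A \<inter> B = {0}"
    using assms by (auto simp: direct_sum_decomp_def)
  have "a' - a \<in> A"
    using a' assms sub cvs.subspace_diff by blast
  moreover have "b - (a + b - a') \<in> B"
    using a' assms sub cvs.subspace_diff by blast
  then have "a' - a \<in> B"
    by simp
  ultimately have "a' - a = 0"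
    using int by blast
  then show "a' = a"
    by simp
qed

lemma direct_sum_decomp_commute: "direct_sum_decomp A B \<Longrightarrow> direct_sum_decomp B A"
  unfolding direct_sum_decomp_def by (metis Int_commute add.commute)

lemma pol_J_add:
  assumes "direct_sum_decomp Wp Wm" "a \<in> Wp" "b \<in> Wm"
  shows "pol_J Wp Wm (a + b) = cscale \<i> (a - b)"
  using proj_along_add[OF assms] proj_along_add[OF direct_sum_decomp_commute, OF assms(1,3,2)]
  by (simp add: pol_J_def add.commute)

lemma pol_J_linear:
  assumes dec: "direct_sum_decomp Wp Wm"
  shows "pol_J Wp Wm (u + v) = pol_J Wp Wm u + pol_J Wp Wm v"
    and "pol_J Wp Wm (cscale c u) = cscale c (pol_J Wp Wm u)"
    and "pol_J Wp Wm (pol_J Wp Wm u) = - u"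
proof -
  have sub: "cvs.subspace Wp" "cvs.subspace Wm"
    and sum: "\<And>z. \<exists>a\<in>Wp. \<exists>b\<in>Wm. z = a + b"
    using dec by (auto simp: direct_sum_decomp_def)
  note closed = cvs.subspace_add[OF sub(1)] cvs.subspace_add[OF sub(2)]
    cvs.subspace_scale[OF sub(1)] cvs.subspace_scale[OF sub(2)]
  obtain a b where u: "a \<in> Wp" "b \<in> Wm" "u = a + b"
    using sum by blast
  obtain a' b' where v: "a' \<in> Wp" "b' \<in> Wm" "v = a' + b'"
    using sum by blast
  have Ju: "pol_J Wp Wm u = cscale \<i> (a - b)"
    unfolding u(3) by (rule pol_J_add[OF dec u(1,2)])
  have Jv: "pol_J Wp Wm v = cscale \<i> (a' - b')"
    unfolding v(3) by (rule pol_J_add[OF dec v(1,2)])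
  have "u + v = (a + a') + (b + b')"
    by (simp add: u v)
  then have "pol_J Wp Wm (u + v) = cscale \<i> ((a + a') - (b + b'))"
    using pol_J_add[OF dec closed(1)[OF u(1) v(1)] closed(2)[OF u(2) v(2)]] by simp
  also have "\<dots> = pol_J Wp Wm u + pol_J Wp Wm v"
    unfolding Ju Jv by (simp add: cscale_def algebra_simps)
  finally show "pol_J Wp Wm (u + v) = pol_J Wp Wm u + pol_J Wp Wm v" .
  have "cscale c u = cscale c a + cscale c b"
    by (simp add: u cvs.scale_right_distrib)
  then have "pol_J Wp Wm (cscale c u) = cscale \<i> (cscale c a - cscale c b)"
    using pol_J_add[OF dec closed(3)[OF u(1)] closed(4)[OF u(2)]] by simp
  also have "\<dots> = cscale c (pol_J Wp Wm u)"
    unfolding Ju by (simp add: cvs.scale_right_diff_distrib mult.commute)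
  finally show "pol_J Wp Wm (cscale c u) = cscale c (pol_J Wp Wm u)" .
  have "pol_J Wp Wm u = cscale \<i> a + cscale (- \<i>) b"
    unfolding Ju by (simp add: cvs.scale_right_diff_distrib)
  then have "pol_J Wp Wm (pol_J Wp Wm u) = cscale \<i> (cscale \<i> a - cscale (- \<i>) b)"
    using pol_J_add[OF dec closed(3)[OF u(1)] closed(4)[OF u(2)]] by (simp only:)
  also have "\<dots> = - u"
    by (simp add: u(3) cscale_def prod_eq_iff)
  finally show "pol_J Wp Wm (pol_J Wp Wm u) = - u" .
qed

lemma alpha_simps:
  "alpha (u + v) = alpha u + alpha v" "alpha (u - v) = alpha u - alpha v"
  "alpha (alpha u) = u" "alpha (cscale c u) = cscale (cnj c) (alpha u)"
  by (auto simp: alpha_def cscale_def)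

text \<open>
  Conjugation swaps the two components, which changes the sign of their difference, and conjugates
  the factor \<open>\<i>\<close>; the two signs cancel.
\<close>
lemma pol_J_alpha:
  assumes dec: "direct_sum_decomp Wp Wm" and "alpha ` Wp = Wm"
  shows "pol_J Wp Wm (alpha u) = alpha (pol_J Wp Wm u)"
proof -
  obtain a b where u: "a \<in> Wp" "b \<in> Wm" "u = a + b"
    using dec unfolding direct_sum_decomp_def by blast
  have "alpha a \<in> Wm" "alpha b \<in> Wp"
    using u assms(2) by (auto simp: alpha_simps)
  then have "pol_J Wp Wm (alpha b + alpha a) = cscale \<i> (alpha b - alpha a)"
    by (intro pol_J_add[OF dec])
  also have "alpha b + alpha a = alpha u"
    by (simp add: u alpha_simps)
  also have "cscale \<i> (alpha b - alpha a) = alpha (cscale \<i> (a - b))"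
    by (simp add: alpha_def cscale_def)
  also have "cscale \<i> (a - b) = pol_J Wp Wm u"
    unfolding u(3) by (rule pol_J_add[OF dec u(1,2), symmetric])
  finally show ?thesis .
qed

text \<open>
  Commuting with conjugation, the map preserves the real vectors, and complex linearity determines
  it from its restriction to them.
\<close>
lemma pol_J_real:
  assumes dec: "direct_sum_decomp Wp Wm" and al: "alpha ` Wp = Wm"
  obtains J where "linear J" "\<And>v. J (J v) = - v" "\<And>z. pol_J Wp Wm z = (J (fst z), J (snd z))"
proof -
  define J where "J v = fst (pol_J Wp Wm (cembed v))" for v
  note J_lin = pol_J_linear[OF dec]
  have real: "pol_J Wp Wm (cembed v) = cembed (J v)" for v
  proof -
    have "alpha (pol_J Wp Wm (cembed v)) = pol_J Wp Wm (cembed v)"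
      using pol_J_alpha[OF assms, of "cembed v"] by (simp add: alpha_def cembed_def)
    then have "pol_J Wp Wm (cembed v) \<in> range cembed"
      by (simp only: alpha_fixed_iff)
    then show ?thesis
      by (auto simp: J_def cembed_def)
  qed
  have ext: "pol_J Wp Wm z = (J (fst z), J (snd z))" for z
  proof -
    have "z = cembed (fst z) + cscale \<i> (cembed (snd z))"
      by (simp add: cembed_def cscale_def)
    then have "pol_J Wp Wm z = cembed (J (fst z)) + cscale \<i> (cembed (J (snd z)))"
      by (metis J_lin(1,2) real)
    then show ?thesis
      by (simp add: cembed_def cscale_def)
  qed
  have "linear J"
  proof (rule linearI)
    show "J (v + w) = J v + J w" for v w
      using J_lin(1)[of "cembed v" "cembed w"] by (simp add: ext cembed_def)
    show "J (r *\<^sub>R v) = r *\<^sub>R J v" for r v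
      using J_lin(2)[of "of_real r" "cembed v"] by (simp add: ext cembed_def cscale_def)
  qed
  moreover have "J (J v) = - v" for v
    using J_lin(3)[of "cembed v"] by (simp add: ext cembed_def)
  ultimately show thesis
    using ext that by blast
qed

text \<open>
  Isotropy leaves only the pairings between the two halves, whose eigenvalues \<open>\<i>\<close> and \<open>-\<i>\<close> have
  product \<open>1\<close>.
\<close>
lemma pol_J_invariant:
  assumes "bounded_bilinear \<omega>" "direct_sum_decomp Wp Wm" "isotropic \<omega> Wp" "isotropic \<omega> Wm"
  shows "cbilinear_ext \<omega> (pol_J Wp Wm u) (pol_J Wp Wm v) = cbilinear_ext \<omega> u v"
proof -
  have sum: "\<And>z. \<exists>a\<in>Wp. \<exists>b\<in>Wm. z = a + b"
    using assms(2) by (auto simp: direct_sum_decomp_def)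
  obtain a b where u: "a \<in> Wp" "b \<in> Wm" "u = a + b"
    using sum by blast
  obtain a' b' where v: "a' \<in> Wp" "b' \<in> Wm" "v = a' + b'"
    using sum by blast
  have "cbilinear_ext \<omega> a a' = 0" "cbilinear_ext \<omega> b b' = 0"
    using u v assms by (auto simp: isotropic_def)
  then show ?thesis
    unfolding u(3) v(3) pol_J_add[OF assms(2) u(1,2)] pol_J_add[OF assms(2) v(1,2)]
    by (simp add: cbilinear_ext_simps[OF assms(1)] complex_eq_iff)
qed

text \<open>
  Uniqueness of the decomposition forces a real vector to have the form \<open>a + alpha a\<close> with \<open>a\<close> in
  \<open>Wp\<close>. By isotropy and skew symmetry, the value in question is twice that of the positive form
  of the polarization at \<open>a\<close>.
\<close>
lemma polarization_taming:
  assumes "strong_symplectic_form \<omega>" "positive_symplectic_polarization \<omega> Wp Wm" "x \<noteq> 0"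
  shows "0 < Re (cbilinear_ext \<omega> (cembed x) (pol_J Wp Wm (cembed x)))"
proof -
  have bb: "bounded_bilinear \<omega>" and skew: "\<And>v w. \<omega> v w = - \<omega> w v"
    using assms(1) unfolding strong_symplectic_form_def by blast+
  have dec: "direct_sum_decomp Wp Wm" and iso: "isotropic \<omega> Wp" "isotropic \<omega> Wm"
    and al: "alpha ` Wp = Wm"
    and pos: "positive_definite_on Wp (\<lambda>v w. - \<i> * cbilinear_ext \<omega> v (alpha w))"
    using assms(2) by (auto simp: positive_symplectic_polarization_def lagrangian_def)
  obtain a b where ab: "a \<in> Wp" "b \<in> Wm" "cembed x = a + b"
    using dec unfolding direct_sum_decomp_def by blast
  have in_W: "alpha a \<in> Wm" "alpha b \<in> Wp"
    using ab al by (auto simp: alpha_simps)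
  have "alpha (a + b) = a + b"
    unfolding ab(3)[symmetric] alpha_fixed_iff by (rule rangeI)
  then have "a + b = alpha b + alpha a"
    by (metis alpha_simps(1) add.commute)
  then have "a = alpha b"
    using proj_along_add[OF dec ab(1,2)] proj_along_add[OF dec in_W(2,1)] by metis
  then have b: "b = alpha a"
    by (simp add: alpha_simps)
  have "a \<noteq> 0"
    using assms(3) ab(3) by (auto simp: b alpha_def cembed_def)
  have "cbilinear_ext \<omega> a a = 0" "cbilinear_ext \<omega> b b = 0"
    using ab iso by (auto simp: isotropic_def)
  moreover have "cbilinear_ext \<omega> b a = - cbilinear_ext \<omega> a b"
    using skew[of "fst b" "fst a"] skew[of "snd b" "snd a"] skew[of "fst b" "snd a"]
      skew[of "snd b" "fst a"]
    by (simp add: cbilinear_ext_def complex_eq_iff)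
  ultimately have "cbilinear_ext \<omega> (a + b) (cscale \<i> (a - b)) = 2 * (- \<i> * cbilinear_ext \<omega> a b)"
    by (simp add: cbilinear_ext_simps[OF bb] algebra_simps)
  moreover have "0 < Re (- \<i> * cbilinear_ext \<omega> a b)"
    using pos ab(1) \<open>a \<noteq> 0\<close> by (simp add: positive_definite_on_def b)
  ultimately show ?thesis
    by (simp add: ab(3) pol_J_add[OF dec ab(1,2)])
qed

section \<open>Positive polarizations give compatible triples\<close>

theorem proposition3p22:
  fixes \<omega> :: "'h::{real_inner,polish_space} \<Rightarrow> 'h \<Rightarrow> real"
    and Wp Wm :: "('h \<times> 'h) set"
  assumes "strong_symplectic_form \<omega>"
    and "positive_symplectic_polarization \<omega> Wp Wm"
  shows "(\<exists>J g. (\<forall>v. pol_J Wp Wm (cembed v) = cembed (J v)) \<and>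
                (\<forall>v w. pol_g \<omega> Wp Wm (cembed v) (cembed w) = complex_of_real (g v w)) \<and>
                complex_structure J \<and> strong_inner_product g \<and> compatible_triple g J \<omega>) \<and>
         csesquilinear_on UNIV (pol_g \<omega> Wp Wm) \<and>
         positive_definite_on UNIV (pol_g \<omega> Wp Wm) \<and>
         hilbert_space_wrt (pol_g \<omega> Wp Wm)"
proof -
  have bb: "bounded_bilinear \<omega>"
    using assms(1) by (simp add: strong_symplectic_form_def)
  have dec: "direct_sum_decomp Wp Wm" and iso: "isotropic \<omega> Wp" "isotropic \<omega> Wm"
    and al: "alpha ` Wp = Wm"
    using assms(2) by (auto simp: positive_symplectic_polarization_def lagrangian_def)
  interpret \<omega>: bounded_bilinear \<omega> by fact
  obtain J where J: "linear J" "\<And>v. J (J v) = - v"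
    and pol_J: "\<And>z. pol_J Wp Wm z = (J (fst z), J (snd z))"
    using pol_J_real[OF dec al] by metis
  define g where "g v w = \<omega> v (J w)" for v w
  have real: "pol_J Wp Wm (cembed v) = cembed (J v)" for v
    by (simp add: pol_J cembed_def linear_0[OF J(1)])
  have on_H: "cbilinear_ext \<omega> (cembed v) (cembed w) = complex_of_real (\<omega> v w)" for v w
    by (simp add: cbilinear_ext_def cembed_def \<omega>.zero_left \<omega>.zero_right complex_eq_iff)
  have "\<omega> (J v) (J w) = \<omega> v w" for v w
    using pol_J_invariant[OF bb dec iso, of "cembed v" "cembed w"] by (simp add: real on_H)
  moreover have "0 \<le> \<omega> v (J v)" for v
    using polarization_taming[OF assms, of v]
    by (cases "v = 0") (auto simp: real on_H \<omega>.zero_left)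
  ultimately have triple: "compatible_triple g J \<omega>"
    using tamed_symplectic_compatible[OF assms(1), of J] J by (simp add: g_def[abs_def])
  then have g: "strong_inner_product g"
    by (simp add: compatible_triple_def)
  have pol_g: "pol_g \<omega> Wp Wm = (\<lambda>v w. cbilinear_ext g v (alpha w))"
    by (simp add: fun_eq_iff pol_g_def pol_J g_def cbilinear_ext_def alpha_def)
  have "hilbert_space_wrt (pol_g \<omega> Wp Wm)"
    unfolding pol_g by (rule hermitian_extension_hilbert[OF g])
  moreover have "pol_g \<omega> Wp Wm (cembed v) (cembed w) = complex_of_real (g v w)" for v w
  proof -
    have "alpha (cembed w) = cembed w"
      by (simp add: alpha_fixed_iff)
    then show ?thesis
      by (simp add: pol_g_def real on_H g_def)
  qed
  moreover have "complex_structure J"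
    using triple by (simp add: compatible_triple_def)
  ultimately show ?thesis
    using real triple g unfolding hilbert_space_wrt_def by blast
qed

end
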